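(* Consider the problem $\min\{f(x):x\in X,\ g(x)\le0\}$ with a solution $x_*$ (the convex function $f$ is not assumed Lipschitz). Assume that for some constant $M_g$ $$|g(x)-g(y)|\le M_g\|x-y\|_E\qquad\text{for all }x,y\in X,$$ and that $\Theta_0>0$ is a known constant with $d(x_* )\le\Theta_0^2$. Let $\varepsilon>0$. Then the Adaptive Mirror Descent algorithm for general convex objective (described in the context), run with inputs $\varepsilon$ and $\Theta_0$, stops after not more than $$k=\left\lceil\frac{2\max\{1,M_g^2\}\,\Theta_0^2}{\varepsilon^2}\right\rceil$$ iterations, and, with $I$ the set of productive steps and $\bar x^k$ the output, it holds that $$\min_{i\in I}v_f[x_*](x^i)\le\varepsilon\qquad\text{and}\qquad g(\bar x^k)\le\varepsilon .$$
   Context: **Problem.** $E$ is a finite-dimensional real vector space with norm $\|\cdot\|_E$, $E^*$ its dual, $\langle p,x\rangle$ the value of $p\in E^*$ at $x\in E$, and $\|p\|_{E,*}=\max\{\langle p,x\rangle:\|x\|_E\le1\}$. $X\subset E$ is closed and convex; $f:X\to\mathbb{R}$ and $g:E\to\mathbb{R}$ are convex. The problem is regular: there is a point $\bar x$ in the relative interior of $X$ with $g(\bar x)<0$. $\nabla f(x)$, $\nabla g(x)$ denote any subgradients of $f$, $g$ at $x$. For $y\in X$ and $x\in X$, $$v_f[y](x)=\Big\langle\frac{\nabla f(x)}{\|\nabla f(x)\|_{E,*}},x-y\Big\rangle\ \text{ if }\nabla f(x)\ne0,\qquad v_f[y](x)=0\ \text{ if }\nabla f(x)=0 .$$ **Proximal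 setup.** $d$ is a prox-function: it is continuous and convex on $X$; on the set $X^0\subseteq X$ of points where a subgradient of $d$ exists it admits a continuous selection of subgradients $\nabla d(x)$; it is 1-strongly convex: $d(y)-d(x)-\langle\nabla d(x),y-x\rangle\ge\frac12\|y-x\|_E^2$ for $x\in X^0,y\in X$; and $\min_{x\in X}d(x)=0$. For $z\in X^0$, $x\in X$ the Bregman divergence is $V[z](x)=d(x)-d(z)-\langle\nabla d(z),x-z\rangle$. For $x\in X^0$, $p\in E^*$, $\mathrm{Mirr}[x](p)=\arg\min_{u\in X}\{\langle p,u\rangle+V[x](u)\}$, assumed to be easily computable. **Algorithm.** Start with $x^0=\arg\min_{x\in X}d(x)$, $I=\emptyset$, $k=0$. Repeat: - if $g(x^k)\le\varepsilon$ (productive step): $h_k=\varepsilon/\|\nabla f(x^k)\|_{E,*}$, $x^{k+1}=\mathrm{Mirr}[x^k](h_k\nabla f(x^k))$, and add $k$ to $I$; - otherwise (non-productive step): $h_k=\varepsilon/\|\nabla g(x^k)\|_{E,*}^2$, $x^{k+1}=\mathrm{Mirr}[x^k](h_k\nabla g(x^k))$; - set $k\leftarrow k+1$; until $|I|+\sum_{j\in J}\frac1{\|\nabla g(x^j)\|_{E,*}^2}\ge\frac{2\Theta_0^2}{\varepsilon^2}$, where $J=\{0,\dots,k-1\}\setminus I$ and $|I|$ is the number of elements of $I$. Output $\bar x^k=\arg\min_{x^j,\,j\in I}f(x^j)$.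
   Formalization: The formal theorem additionally assumes that the chosen subgradient satisfies ‖∇g(y)‖_{E,*} ≤ M_g at boundary points y of X with g(y) > ε; with g Lipschitz only on X and arbitrary subgradients, the stated iteration bound can fail. *)

theory Defs
  imports "HOL-Analysis.Analysis"
begin

text \<open>
  The dual of a finite-dimensional normed space \<open>'a\<close> is \<open>'a \<Rightarrow>\<^sub>L real\<close>; the library norm on it is the
  dual norm:
\<close>

lemma norm_blinfun_eq_dual_norm:
  fixes p :: "'a::real_normed_vector \<Rightarrow>\<^sub>L real"
  shows "norm p = (SUP x\<in>cball 0 1. blinfun_apply p x)"
proof -
  have le: "blinfun_apply p x \<le> norm p" if "x \<in> cball 0 1" for x
  proof -
    have "blinfun_apply p x \<le> norm p * norm x"
      using norm_blinfun[of p x] by simp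
    also have "\<dots> \<le> norm p * 1"
      using that by (intro mult_left_mono) auto
    finally show ?thesis by simp
  qed
  then have bdd: "bdd_above (blinfun_apply p ` cball 0 1)"
    by (intro bdd_aboveI2[where M = "norm p"])
  let ?S = "SUP x\<in>cball 0 1. blinfun_apply p x"
  have nonneg: "0 \<le> ?S"
    using cSUP_upper[OF _ bdd, of 0] by (simp add: blinfun.zero_right)
  have "norm (blinfun_apply p x) \<le> ?S * norm x" for x
  proof (cases "x = 0")
    case False
    have "blinfun_apply p (x /\<^sub>R norm x) \<le> ?S" "blinfun_apply p (- (x /\<^sub>R norm x)) \<le> ?S"
      using False by (intro cSUP_upper[OF _ bdd]; simp)+
    then show ?thesis
      using False by (simp add: blinfun.scaleR_right blinfun.minus_right field_simps abs_le_iff)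
  qed (simp add: blinfun.zero_right)
  then have "norm p \<le> ?S"
    using nonneg by (intro norm_blinfun_bound)
  moreover have "?S \<le> norm p"
    using le by (intro cSUP_least) auto
  ultimately show ?thesis by simp
qed

text \<open>Here \<open>S\<close> is the domain on which the function \<open>f\<close> is regarded as being defined.\<close>

definition is_subgradient ::
  "'a::real_normed_vector set \<Rightarrow> ('a \<Rightarrow> real) \<Rightarrow> 'a \<Rightarrow> ('a \<Rightarrow>\<^sub>L real) \<Rightarrow> bool" where
  "is_subgradient S f x p \<longleftrightarrow> x \<in> S \<and> (\<forall>y\<in>S. f x + blinfun_apply p (y - x) \<le> f y)"

definition subdiff_domain :: "'a::real_normed_vector set \<Rightarrow> ('a \<Rightarrow> real) \<Rightarrow> 'a set" where
  "subdiff_domain S f = {x \<in> S. \<exists>p. is_subgradient S f x p}"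

definition bregman ::
  "('a::real_normed_vector \<Rightarrow> real) \<Rightarrow> ('a \<Rightarrow> 'a \<Rightarrow>\<^sub>L real) \<Rightarrow> 'a \<Rightarrow> 'a \<Rightarrow> real" where
  "bregman d Dd z x = d x - d z - blinfun_apply (Dd z) (x - z)"

definition prox_function ::
  "'a::real_normed_vector set \<Rightarrow> ('a \<Rightarrow> real) \<Rightarrow> ('a \<Rightarrow> 'a \<Rightarrow>\<^sub>L real) \<Rightarrow> bool" where
  "prox_function X d Dd \<longleftrightarrow>
     continuous_on X d \<and> convex_on X d \<and>
     (\<forall>x\<in>subdiff_domain X d. is_subgradient X d x (Dd x)) \<and>
     continuous_on (subdiff_domain X d) Dd \<and>
     (\<forall>x\<in>subdiff_domain X d. \<forall>y\<in>X. d y - d x - blinfun_apply (Dd x) (y - x) \<ge> (norm (y - x))\<^sup>2 / 2) \<and>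
     (\<exists>x\<in>X. d x = 0) \<and> (\<forall>x\<in>X. 0 \<le> d x)"

text \<open>\<open>is_mirr X d Dd x p u\<close>: the point \<open>u\<close> is the result of the mirror step \<open>Mirr[x](p)\<close>.\<close>

definition is_mirr ::
  "'a::real_normed_vector set \<Rightarrow> ('a \<Rightarrow> real) \<Rightarrow> ('a \<Rightarrow> 'a \<Rightarrow>\<^sub>L real) \<Rightarrow>
    'a \<Rightarrow> ('a \<Rightarrow>\<^sub>L real) \<Rightarrow> 'a \<Rightarrow> bool" where
  "is_mirr X d Dd x p u \<longleftrightarrow>
     is_arg_min (\<lambda>u. blinfun_apply p u + bregman d Dd x u) (\<lambda>u. u \<in> X) u"

definition v_dist :: "('a::real_normed_vector \<Rightarrow> 'a \<Rightarrow>\<^sub>L real) \<Rightarrow> 'a \<Rightarrow> 'a \<Rightarrow> real" where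
  "v_dist Df y x = (if Df x = 0 then 0 else blinfun_apply (Df x /\<^sub>R norm (Df x)) (x - y))"

text \<open>The sets \<open>I\<close> and \<open>J\<close> after the iterations \<open>0, \<dots>, k - 1\<close>.\<close>

definition productive :: "('a \<Rightarrow> real) \<Rightarrow> real \<Rightarrow> (nat \<Rightarrow> 'a) \<Rightarrow> nat \<Rightarrow> nat set" where
  "productive g \<epsilon> x k = {j. j < k \<and> g (x j) \<le> \<epsilon>}"

definition nonproductive :: "('a \<Rightarrow> real) \<Rightarrow> real \<Rightarrow> (nat \<Rightarrow> 'a) \<Rightarrow> nat \<Rightarrow> nat set" where
  "nonproductive g \<epsilon> x k = {0..<k} - productive g \<epsilon> x k"

definition amd_criterion ::
  "('a::real_normed_vector \<Rightarrow> real) \<Rightarrow> ('a \<Rightarrow> 'a \<Rightarrow>\<^sub>L real) \<Rightarrow> real \<Rightarrow> real \<Rightarrow> (nat \<Rightarrow> 'a) \<Rightarrow> nat \<Rightarrow> bool"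
  where
  "amd_criterion g Dg \<epsilon> \<Theta>\<^sub>0 x k \<longleftrightarrow>
     real (card (productive g \<epsilon> x k)) + (\<Sum>j\<in>nonproductive g \<epsilon> x k. 1 / (norm (Dg (x j)))\<^sup>2)
       \<ge> 2 * \<Theta>\<^sub>0\<^sup>2 / \<epsilon>\<^sup>2"

text \<open>
  In a productive step with \<open>Df x = 0\<close> the step size \<open>\<epsilon> / 0\<close> is immaterial, because it multiplies
  the zero functional. In a nonproductive step \<open>Dg x\<close> cannot vanish if \<open>\<epsilon>\<close> is positive and \<open>g\<close> is
  negative somewhere.
\<close>

definition amd_step ::
  "'a::real_normed_vector set \<Rightarrow> ('a \<Rightarrow> real) \<Rightarrow> ('a \<Rightarrow> 'a \<Rightarrow>\<^sub>L real) \<Rightarrow>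
    ('a \<Rightarrow> real) \<Rightarrow> ('a \<Rightarrow> 'a \<Rightarrow>\<^sub>L real) \<Rightarrow> ('a \<Rightarrow> real) \<Rightarrow> ('a \<Rightarrow> 'a \<Rightarrow>\<^sub>L real) \<Rightarrow>
    real \<Rightarrow> 'a \<Rightarrow> 'a \<Rightarrow> bool" where
  "amd_step X f Df g Dg d Dd \<epsilon> x x' \<longleftrightarrow>
     (if g x \<le> \<epsilon>
      then is_subgradient X f x (Df x) \<and>
           is_mirr X d Dd x ((\<epsilon> / norm (Df x)) *\<^sub>R Df x) x'
      else is_subgradient UNIV g x (Dg x) \<and>
           is_mirr X d Dd x ((\<epsilon> / (norm (Dg x))\<^sup>2) *\<^sub>R Dg x) x')"

text \<open>
  The loop has the form repeat-until: the criterion is tested after every iteration, so that the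
  iteration with index \<open>k\<close> is performed iff the criterion failed after each of the earlier ones.
  \<open>amd_stops_after \<dots> N\<close> says that the algorithm stops after exactly \<open>N\<close> iterations. In a run that
  stops, the values \<open>x k\<close> with \<open>k > N\<close> are unconstrained.
\<close>

definition amd_run ::
  "'a::real_normed_vector set \<Rightarrow> ('a \<Rightarrow> real) \<Rightarrow> ('a \<Rightarrow> 'a \<Rightarrow>\<^sub>L real) \<Rightarrow>
    ('a \<Rightarrow> real) \<Rightarrow> ('a \<Rightarrow> 'a \<Rightarrow>\<^sub>L real) \<Rightarrow> ('a \<Rightarrow> real) \<Rightarrow> ('a \<Rightarrow> 'a \<Rightarrow>\<^sub>L real) \<Rightarrow>
    real \<Rightarrow> real \<Rightarrow> (nat \<Rightarrow> 'a) \<Rightarrow> bool" where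
  "amd_run X f Df g Dg d Dd \<epsilon> \<Theta>\<^sub>0 x \<longleftrightarrow>
     is_arg_min d (\<lambda>u. u \<in> X) (x 0) \<and>
     (\<forall>k. (\<forall>m\<in>{1..k}. \<not> amd_criterion g Dg \<epsilon> \<Theta>\<^sub>0 x m) \<longrightarrow>
          amd_step X f Df g Dg d Dd \<epsilon> (x k) (x (Suc k)))"

definition amd_stops_after ::
  "('a::real_normed_vector \<Rightarrow> real) \<Rightarrow> ('a \<Rightarrow> 'a \<Rightarrow>\<^sub>L real) \<Rightarrow> real \<Rightarrow> real \<Rightarrow> (nat \<Rightarrow> 'a) \<Rightarrow> nat \<Rightarrow> bool"
  where
  "amd_stops_after g Dg \<epsilon> \<Theta>\<^sub>0 x N \<longleftrightarrow>
     1 \<le> N \<and> amd_criterion g Dg \<epsilon> \<Theta>\<^sub>0 x N \<and> (\<forall>m\<in>{1..<N}. \<not> amd_criterion g Dg \<epsilon> \<Theta>\<^sub>0 x m)"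

definition amd_output ::
  "('a \<Rightarrow> real) \<Rightarrow> ('a \<Rightarrow> real) \<Rightarrow> real \<Rightarrow> (nat \<Rightarrow> 'a) \<Rightarrow> nat \<Rightarrow> 'a \<Rightarrow> bool" where
  "amd_output f g \<epsilon> x N u \<longleftrightarrow> is_arg_min f (\<lambda>u. u \<in> x ` productive g \<epsilon> x N) u"

end

theory Submission
  imports Defs
begin

text \<open>
  The Bregman divergence \<open>V[x\<^sup>k](x\<^sub>*)\<close> is a potential. It is at most \<open>\<Theta>\<^sub>0\<^sup>2\<close> at the start and
  never negative. A mirror step along \<open>p\<close> satisfies
  \<open>\<langle>p, x - u\<rangle> \<le> V[x](u) - V[x'](u) + \<parallel>p\<parallel>\<^sup>2 / 2\<close> (lemma \<open>mirror_step_inequality\<close>). Assign to a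
  productive iteration the weight \<open>1\<close> and to a nonproductive one the weight
  \<open>1 / \<parallel>\<nabla>g(x\<^sup>k)\<parallel>\<^sup>2\<close>, so that the stopping criterion says that the total weight has reached
  \<open>2 \<Theta>\<^sub>0\<^sup>2 / \<epsilon>\<^sup>2\<close>. The step sizes are such that an iteration lowers the potential by more than
  \<open>\<epsilon>\<^sup>2 / 2\<close> times its weight, except possibly at a productive point with \<open>v\<^sub>f[x\<^sub>*](x\<^sup>k) \<le> \<epsilon>\<close>
  (lemma \<open>amd_step_decrease\<close>). Without such a point the total weight would stay below
  \<open>2 \<Theta>\<^sub>0\<^sup>2 / \<epsilon>\<^sup>2\<close>, and the criterion could not hold. Every weight is at least
  \<open>1 / max 1 (M\<^sub>g\<^sup>2)\<close>, and this bounds the number of iterations.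

  The delicate point is the mirror step itself. A minimizer \<open>y\<close> of \<open>d + q\<close> on \<open>X\<close> has \<open>- q\<close> as a
  subgradient of \<open>d\<close>, but the selected subgradient \<open>\<nabla>d(y)\<close> can be another one when \<open>y\<close> is on the
  boundary of \<open>X\<close>. Continuity of the selection gives nevertheless \<open>\<langle>q + \<nabla>d(y), u - y\<rangle> \<ge> 0\<close> for
  all \<open>u \<in> X\<close>: approach \<open>y\<close> along a segment on which \<open>\<nabla>d\<close> is defined (lemma
  \<open>prox_variational_inequality\<close>). Segments towards relatively interior points are of this kind,
  because a convex function on a finite-dimensional set has a subgradient at every such point
  (lemma \<open>intrinsic_core_subset_subdiff_domain\<close>). This is a finite-dimensional case of the
  Hahn-Banach theorem, and here the functionals found must also be shown to be bounded.
\<close>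

section \<open>Linear functionals on finite-dimensional normed spaces\<close>

text \<open>
  The coefficient of a vector outside a closed subspace is a bounded function of the sum. With this
  estimate, completeness and boundedness pass from \<open>span A\<close> to \<open>span (insert b A)\<close>.
\<close>

lemma norm_add_scaleR_ge_of_not_mem_subspace:
  fixes b :: "'a::real_normed_vector"
  assumes "subspace S" "closed S" "b \<notin> S"
  obtains r where "0 < r" "\<And>v c. v \<in> S \<Longrightarrow> r * \<bar>c\<bar> \<le> norm (v + c *\<^sub>R b)"
proof -
  have "open (- S)" "b \<in> - S"
    using assms by auto
  then obtain r where r: "0 < r" "ball b r \<subseteq> - S"
    by (meson open_contains_ball)
  have "r * \<bar>c\<bar> \<le> norm (v + c *\<^sub>R b)" if v: "v \<in> S" for v c
  proof (cases "c = 0")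
    case False
    have "(- 1 / c) *\<^sub>R v \<in> S"
      using assms(1) v by (rule subspace_scale)
    then have "(- 1 / c) *\<^sub>R v \<notin> ball b r"
      using r(2) by auto
    then have "r \<le> norm (b - (- 1 / c) *\<^sub>R v)"
      by (simp add: dist_norm)
    then have "\<bar>c\<bar> * r \<le> norm (c *\<^sub>R (b - (- 1 / c) *\<^sub>R v))"
      by (simp add: mult_left_mono)
    also have "c *\<^sub>R (b - (- 1 / c) *\<^sub>R v) = v + c *\<^sub>R b"
      using False by (simp add: scaleR_add_right)
    finally show ?thesis by (simp add: mult.commute)
  qed simp
  with r(1) show ?thesis by (rule that)
qed

lemma Cauchy_of_dist_le:
  assumes "Cauchy w" and lip: "\<And>m n. dist (u m) (u n) \<le> L * dist (w m) (w n)"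
  shows "Cauchy u"
proof (rule metric_CauchyI)
  fix e :: real assume "0 < e"
  then have "0 < e / (\<bar>L\<bar> + 1)" by simp
  with assms(1) obtain M
    where M: "\<And>m n. m \<ge> M \<Longrightarrow> n \<ge> M \<Longrightarrow> dist (w m) (w n) < e / (\<bar>L\<bar> + 1)"
    by (meson metric_CauchyD)
  have "dist (u m) (u n) < e" if "m \<ge> M" "n \<ge> M" for m n
  proof -
    have "dist (u m) (u n) \<le> (\<bar>L\<bar> + 1) * dist (w m) (w n)"
      using lip[of m n] by (rule order_trans) (intro mult_right_mono, auto)
    also have "\<dots> < (\<bar>L\<bar> + 1) * (e / (\<bar>L\<bar> + 1))"
      using M[OF that] by (intro mult_strict_left_mono) auto
    also have "\<dots> = e" by simp
    finally show ?thesis .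
  qed
  then show "\<exists>M. \<forall>m\<ge>M. \<forall>n\<ge>M. dist (u m) (u n) < e" by blast
qed

text \<open>
  When a Cauchy sequence in \<open>span (insert b A)\<close> is split into multiples of \<open>b\<close> and vectors of
  \<open>span A\<close>, both parts are Cauchy, since they depend on the sum in a Lipschitz way.
\<close>

lemma complete_span_of_finite:
  fixes A :: "'a::real_normed_vector set"
  assumes "finite A"
  shows "complete (span A)"
  using assms
proof (induction A)
  case empty
  then show ?case by (simp add: compact_imp_complete)
next
  case (insert b A)
  show ?case
  proof (cases "b \<in> span A")
    case True
    then show ?thesis using insert.IH by (simp add: span_redundant)
  next
    case False
    obtain r where r: "0 < r" "\<And>v c. v \<in> span A \<Longrightarrow> r * \<bar>c\<bar> \<le> norm (v + c *\<^sub>R b)"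
      using norm_add_scaleR_ge_of_not_mem_subspace[OF subspace_span
          complete_imp_closed[OF insert.IH] False] by blast
    show ?thesis
      unfolding complete_def
    proof (intro allI impI, elim conjE)
      fix w assume w: "\<forall>n. w n \<in> span (insert b A)" "Cauchy w"
      then obtain c where c: "\<And>n. w n - c n *\<^sub>R b \<in> span A"
        unfolding span_breakdown_eq by metis
      have lip: "dist (c m) (c n) \<le> 1 / r * dist (w m) (w n)" for m n
      proof -
        have "(w m - c m *\<^sub>R b) - (w n - c n *\<^sub>R b) \<in> span A"
          using c[of m] c[of n] by (rule span_diff)
        from r(2)[OF this, of "c m - c n"] show ?thesis
          using r(1) by (simp add: dist_norm field_simps)
      qed
      have "Cauchy c"
        using w(2) lip by (rule Cauchy_of_dist_le)
      then obtain c0 where c0: "c \<longlonglongrightarrow> c0"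
        using Cauchy_convergent convergent_def by blast
      then have cb: "(\<lambda>n. c n *\<^sub>R b) \<longlonglongrightarrow> c0 *\<^sub>R b"
        by (intro tendsto_intros)
      have "Cauchy (\<lambda>n. w n - c n *\<^sub>R b)"
        using w(2)
      proof (rule Cauchy_of_dist_le)
        fix m n
        have "dist (w m - c m *\<^sub>R b) (w n - c n *\<^sub>R b)
            = norm ((w m - w n) - (c m - c n) *\<^sub>R b)"
          unfolding dist_norm scaleR_diff_left by (rule arg_cong[where f = norm]) simp
        also have "\<dots> \<le> dist (w m) (w n) + dist (c m) (c n) * norm b"
          using norm_triangle_ineq4[of "w m - w n" "(c m - c n) *\<^sub>R b"] by (simp add: dist_norm)
        also have "\<dots> \<le> dist (w m) (w n) + 1 / r * dist (w m) (w n) * norm b"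
          using lip by (intro add_left_mono mult_right_mono) auto
        finally show "dist (w m - c m *\<^sub>R b) (w n - c n *\<^sub>R b)
            \<le> (1 + norm b / r) * dist (w m) (w n)"
          by (simp add: algebra_simps)
      qed
      then obtain v where v: "v \<in> span A" "(\<lambda>n. w n - c n *\<^sub>R b) \<longlonglongrightarrow> v"
        using completeE[OF insert.IH] c by metis
      have "w \<longlonglongrightarrow> v + c0 *\<^sub>R b"
        using tendsto_add[OF v(2) cb] by simp
      moreover have "v + c0 *\<^sub>R b \<in> span (insert b A)"
        unfolding span_breakdown_eq using v(1) by (intro exI[of _ c0]) simp
      ultimately show "\<exists>l\<in>span (insert b A). w \<longlonglongrightarrow> l" by blast
    qed
  qed
qed

lemma linear_functional_bounded_on_finite_span:
  fixes \<phi> :: "'a::real_normed_vector \<Rightarrow> real"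
  assumes "finite A" "linear \<phi>"
  shows "\<exists>K\<ge>0. \<forall>v\<in>span A. \<bar>\<phi> v\<bar> \<le> K * norm v"
  using assms(1)
proof (induction A)
  case empty
  then show ?case using linear_0[OF assms(2)] by auto
next
  case (insert b A)
  then obtain K where K: "K \<ge> 0" "\<And>v. v \<in> span A \<Longrightarrow> \<bar>\<phi> v\<bar> \<le> K * norm v"
    by blast
  show ?case
  proof (cases "b \<in> span A")
    case True
    then show ?thesis using K by (auto simp: span_redundant)
  next
    case False
    obtain r where r: "0 < r" "\<And>v c. v \<in> span A \<Longrightarrow> r * \<bar>c\<bar> \<le> norm (v + c *\<^sub>R b)"
      using norm_add_scaleR_ge_of_not_mem_subspace[OF subspace_span
          complete_imp_closed[OF complete_span_of_finite[OF insert.hyps(1)]] False] by blast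
    let ?M = "K * norm b + \<bar>\<phi> b\<bar>"
    have "\<bar>\<phi> w\<bar> \<le> (K + ?M / r) * norm w" if "w \<in> span (insert b A)" for w
    proof -
      obtain c where v: "w - c *\<^sub>R b \<in> span A"
        using \<open>w \<in> span (insert b A)\<close> unfolding span_breakdown_eq by blast
      have c: "\<bar>c\<bar> \<le> norm w / r"
        using r(2)[OF v, of c] r(1) by (simp add: field_simps)
      have "\<phi> w = \<phi> (w - c *\<^sub>R b) + c * \<phi> b"
        using assms(2) by (simp add: linear_diff linear_scale)
      then have "\<bar>\<phi> w\<bar> \<le> \<bar>\<phi> (w - c *\<^sub>R b)\<bar> + \<bar>c\<bar> * \<bar>\<phi> b\<bar>"
        by (metis abs_mult abs_triangle_ineq)
      also have "\<dots> \<le> K * (norm w + \<bar>c\<bar> * norm b) + \<bar>c\<bar> * \<bar>\<phi> b\<bar>"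
        using K(2)[OF v] mult_left_mono[OF norm_triangle_ineq4[of w "c *\<^sub>R b"] K(1)] by simp
      also have "\<dots> = K * norm w + \<bar>c\<bar> * ?M"
        by (simp add: algebra_simps)
      also have "\<dots> \<le> K * norm w + (norm w / r) * ?M"
        using c K(1) by (intro add_left_mono mult_right_mono) auto
      finally show ?thesis by (simp add: algebra_simps add_divide_distrib)
    qed
    moreover have "0 \<le> K + ?M / r"
      using K(1) r(1) by (intro add_nonneg_nonneg divide_nonneg_pos) auto
    ultimately show ?thesis by blast
  qed
qed

lemma linear_functional_bounded_of_finite_span:
  fixes \<phi> :: "'a::real_normed_vector \<Rightarrow> real"
  assumes "finite (B::'a set)" "span B = UNIV" "linear \<phi>"
  shows "bounded_linear \<phi>"
proof -
  obtain K where K: "\<forall>v\<in>span B. \<bar>\<phi> v\<bar> \<le> K * norm v"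
    using linear_functional_bounded_on_finite_span[OF assms(1,3)] by blast
  show ?thesis
  proof (rule bounded_linear_intro)
    show "norm (\<phi> v) \<le> norm v * K" for v
      using K assms(2) by (simp add: mult.commute)
  qed (simp_all add: assms(3) linear_add linear_scale)
qed

section \<open>Subgradients at relatively interior points\<close>

text \<open>
  The algebraic relative interior: every segment of \<open>X\<close> that ends in \<open>x\<close> can be prolonged beyond
  \<open>x\<close>. This form is what the Hahn-Banach argument uses, and it makes sense without a topology.
\<close>

definition intrinsic_core :: "'a::real_vector set \<Rightarrow> 'a set" where
  "intrinsic_core X = {x \<in> X. \<forall>w\<in>X. \<exists>\<delta>>0. x - \<delta> *\<^sub>R (w - x) \<in> X}"

lemma rel_interior_subset_intrinsic_core:
  fixes X :: "'a::real_normed_vector set"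
  shows "rel_interior X \<subseteq> intrinsic_core X"
proof
  fix x assume "x \<in> rel_interior X"
  then obtain U where U: "openin (top_of_set (affine hull X)) U" "x \<in> U" "U \<subseteq> X"
    by (auto simp: rel_interior_def)
  then obtain T where "open T" "U = affine hull X \<inter> T"
    by (auto simp: openin_open)
  with U have T: "open T" "x \<in> T" "x \<in> X" "T \<inter> affine hull X \<subseteq> X"
    by auto
  have "\<exists>\<delta>>0. x - \<delta> *\<^sub>R (w - x) \<in> X" if w: "w \<in> X" for w
  proof -
    have "((\<lambda>\<delta>. x - \<delta> *\<^sub>R (w - x)) \<longlongrightarrow> x - 0 *\<^sub>R (w - x)) (at_right 0)"
      by (intro tendsto_intros)
    then have "\<forall>\<^sub>F \<delta> in at_right 0. x - \<delta> *\<^sub>R (w - x) \<in> T"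
      using T(1,2) by (intro topological_tendstoD) auto
    moreover have "\<forall>\<^sub>F \<delta> in at_right (0::real). 0 < \<delta>"
      by (rule eventually_at_right_less)
    ultimately have "\<forall>\<^sub>F \<delta> in at_right 0. 0 < \<delta> \<and> x - \<delta> *\<^sub>R (w - x) \<in> T"
      by eventually_elim auto
    then obtain \<delta> where \<delta>: "0 < \<delta>" "x - \<delta> *\<^sub>R (w - x) \<in> T"
      using eventually_happens'[OF trivial_limit_at_right_real] by blast
    have "(1 + \<delta>) *\<^sub>R x + (- \<delta>) *\<^sub>R w \<in> affine hull X"
      using T(3) w by (intro mem_affine[OF affine_affine_hull] hull_inc) auto
    then have "x - \<delta> *\<^sub>R (w - x) \<in> affine hull X"
      by (simp add: algebra_simps)
    with \<delta> T(4) show ?thesis by blast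
  qed
  with T(3) show "x \<in> intrinsic_core X"
    by (simp add: intrinsic_core_def)
qed

text \<open>
  The prolongation of \<open>[w, z]\<close> beyond \<open>z\<close>, joined to \<open>y\<close>, contains in its triangle a prolongation of
  the segment from \<open>w\<close> to the point \<open>y + t (z - y)\<close>.
\<close>

lemma intrinsic_core_segment:
  fixes X :: "'a::real_vector set"
  assumes "convex X" "z \<in> intrinsic_core X" "y \<in> X" "0 < t" "t \<le> 1"
  shows "y + t *\<^sub>R (z - y) \<in> intrinsic_core X"
proof -
  have zX: "z \<in> X" using assms(2) by (simp add: intrinsic_core_def)
  have seg: "y + m *\<^sub>R (u - y) \<in> X" if "u \<in> X" "0 \<le> m" "m \<le> 1" for u m
  proof -
    have "(1 - m) *\<^sub>R y + m *\<^sub>R u \<in> X"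
      using assms that by (intro convexD_alt) auto
    then show ?thesis by (simp add: algebra_simps)
  qed
  let ?p = "y + t *\<^sub>R (z - y)"
  have "\<exists>\<delta>>0. ?p - \<delta> *\<^sub>R (w - ?p) \<in> X" if "w \<in> X" for w
  proof -
    obtain e where e: "0 < e" "z - e *\<^sub>R (w - z) \<in> X"
      using assms(2) \<open>w \<in> X\<close> unfolding intrinsic_core_def by blast
    \<comment> \<open>The line from \<open>w\<close> through \<open>?p\<close> meets the segment from \<open>y\<close> to \<open>z - e (w - z)\<close> at parameter
      \<open>m = t / D\<close>; the point of intersection is \<open>?p - m e (w - ?p)\<close>.\<close>
    define D where "D = 1 + e * (1 - t)"
    have D: "1 \<le> D" using e assms(4,5) by (simp add: D_def)
    define m where "m = t / D"
    have m: "0 < m" "m \<le> 1" using D assms(4,5) by (auto simp: m_def field_simps)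
    have mt: "m + m * e * (1 - t) = t"
    proof -
      have "m + m * e * (1 - t) = m * D" by (simp add: D_def algebra_simps)
      also have "\<dots> = t" using D by (simp add: m_def)
      finally show ?thesis .
    qed
    have "?p - (m * e) *\<^sub>R (w - ?p) - (y + m *\<^sub>R ((z - e *\<^sub>R (w - z)) - y))
      = (t - (m + m * e * (1 - t))) *\<^sub>R (z - y)"
      by (simp add: algebra_simps)
    then have "?p - (m * e) *\<^sub>R (w - ?p) = y + m *\<^sub>R ((z - e *\<^sub>R (w - z)) - y)"
      by (simp add: mt)
    moreover have "y + m *\<^sub>R ((z - e *\<^sub>R (w - z)) - y) \<in> X"
      using seg[OF e(2), of m] m by simp
    ultimately have "?p - (m * e) *\<^sub>R (w - ?p) \<in> X" by (simp only:)
    then show ?thesis using m e(1) by (intro exI[of _ "m * e"]) simp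
  qed
  then show ?thesis
    using seg[OF zX, of t] assms(4,5) by (simp add: intrinsic_core_def)
qed

text \<open>
  The one-step Hahn-Banach extension, iterated over a finite basis. The value \<open>c\<close> of the extension at
  a new basis vector \<open>b\<close> has to lie above the slopes \<open>L\<close>, which come from points of \<open>C\<close> on the side
  of \<open>- b\<close>, and below the slopes \<open>U\<close>, which come from the side of \<open>b\<close>. Convexity puts \<open>L\<close> below \<open>U\<close>.
  That \<open>0\<close> is in the core rules out that only one of them is empty; otherwise the other one could be
  unbounded, as at an end point of an interval where the graph of \<open>h\<close> becomes vertical.
\<close>

lemma convex_functional_minorant:
  fixes h :: "'a::real_vector \<Rightarrow> real"
  assumes "finite A" "independent A"
    and h: "convex_on C h" "0 \<le> h 0" and core: "0 \<in> intrinsic_core C"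
  shows "\<exists>\<phi>. linear \<phi> \<and> (\<forall>v\<in>C \<inter> span A. \<phi> v \<le> h v)"
  using assms(1,2)
proof (induction A)
  case empty
  then show ?case
    using h(2) by (intro exI[of _ "\<lambda>_. 0"]) (auto simp: linear_zero)
next
  case (insert b A)
  then have ind: "independent (insert b A)" and b: "b \<notin> span A"
    by (auto simp: independent_insert)
  with insert obtain \<phi> where \<phi>: "linear \<phi>" "\<And>v. v \<in> C \<Longrightarrow> v \<in> span A \<Longrightarrow> \<phi> v \<le> h v"
    by (auto simp: independent_insert)
  define L where "L = {(\<phi> v - h (v - s *\<^sub>R b)) / s |v s. v \<in> span A \<and> 0 < s \<and> v - s *\<^sub>R b \<in> C}"
  define U where "U = {(h (v + s *\<^sub>R b) - \<phi> v) / s |v s. v \<in> span A \<and> 0 < s \<and> v + s *\<^sub>R b \<in> C}"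
  have LU: "l \<le> u" if lL: "l \<in> L" and uU: "u \<in> U" for l u
  proof -
    obtain v s where 1: "l = (\<phi> v - h (v - s *\<^sub>R b)) / s" "v \<in> span A" "0 < s" "v - s *\<^sub>R b \<in> C"
      using lL unfolding L_def by blast
    obtain w t where 2: "u = (h (w + t *\<^sub>R b) - \<phi> w) / t" "w \<in> span A" "0 < t" "w + t *\<^sub>R b \<in> C"
      using uU unfolding U_def by blast
    \<comment> \<open>The weights for which the multiples of \<open>b\<close> cancel, so that the convex combination lies in
      \<open>span A\<close>.\<close>
    define a where "a = s / (s + t)"
    have a: "0 \<le> a" "a \<le> 1" "1 - a = t / (s + t)"
      using 1 2 by (auto simp: a_def field_simps)
    let ?c = "(1 - a) *\<^sub>R (v - s *\<^sub>R b) + a *\<^sub>R (w + t *\<^sub>R b)"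
    have "(a * t - (1 - a) * s) = 0" by (simp only: a(3)) (simp add: a_def)
    moreover have "?c = (1 - a) *\<^sub>R v + a *\<^sub>R w + (a * t - (1 - a) * s) *\<^sub>R b"
      by (simp add: algebra_simps)
    ultimately have c: "?c = (1 - a) *\<^sub>R v + a *\<^sub>R w" by simp
    have "convex C" using h(1) by (simp add: convex_on_def)
    then have "?c \<in> C" using 1 2 a by (intro convexD_alt) auto
    moreover have "?c \<in> span A" unfolding c using 1 2 by (intro span_add span_scale)
    ultimately have "\<phi> ?c \<le> h ?c" by (rule \<phi>(2))
    also have "h ?c \<le> (1 - a) * h (v - s *\<^sub>R b) + a * h (w + t *\<^sub>R b)"
      using h(1) 1 2 a by (intro convex_onD) auto
    finally have "(1 - a) * \<phi> v + a * \<phi> w \<le> (1 - a) * h (v - s *\<^sub>R b) + a * h (w + t *\<^sub>R b)"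
      unfolding c using \<phi>(1) by (simp add: linear_add linear_scale)
    then have "t * \<phi> v + s * \<phi> w \<le> t * h (v - s *\<^sub>R b) + s * h (w + t *\<^sub>R b)"
      unfolding a(3) unfolding a_def using 1 2
      by (simp add: add_divide_distrib[symmetric] divide_le_cancel)
    then show ?thesis
      unfolding 1(1) 2(1) using 1(3) 2(3) by (simp add: field_simps)
  qed
  have refl: "\<exists>\<delta>>0. - (\<delta> *\<^sub>R w) \<in> C" if "w \<in> C" for w
    using core that by (auto simp: intrinsic_core_def)
  have LU_empty: "L = {} \<longleftrightarrow> U = {}"
  proof
    assume "L = {}"
    show "U = {}"
    proof (rule ccontr)
      assume "U \<noteq> {}"
      then obtain v s where vs: "v \<in> span A" "0 < s" "v + s *\<^sub>R b \<in> C" unfolding U_def by blast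
      obtain \<delta> where \<delta>: "0 < \<delta>" "- (\<delta> *\<^sub>R (v + s *\<^sub>R b)) \<in> C" using refl vs(3) by blast
      have "(- \<delta>) *\<^sub>R v - (\<delta> * s) *\<^sub>R b \<in> C" using \<delta>(2) by (simp add: algebra_simps)
      moreover have "(- \<delta>) *\<^sub>R v \<in> span A" using vs(1) by (rule span_scale)
      moreover have "0 < \<delta> * s" using \<delta> vs by simp
      ultimately show False using \<open>L = {}\<close> unfolding L_def by blast
    qed
  next
    assume "U = {}"
    show "L = {}"
    proof (rule ccontr)
      assume "L \<noteq> {}"
      then obtain v s where vs: "v \<in> span A" "0 < s" "v - s *\<^sub>R b \<in> C" unfolding L_def by blast
      obtain \<delta> where \<delta>: "0 < \<delta>" "- (\<delta> *\<^sub>R (v - s *\<^sub>R b)) \<in> C" using refl vs(3) by blast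
      have "(- \<delta>) *\<^sub>R v + (\<delta> * s) *\<^sub>R b \<in> C" using \<delta>(2) by (simp add: algebra_simps)
      moreover have "(- \<delta>) *\<^sub>R v \<in> span A" using vs(1) by (rule span_scale)
      moreover have "0 < \<delta> * s" using \<delta> vs by simp
      ultimately show False using \<open>U = {}\<close> unfolding U_def by blast
    qed
  qed
  obtain c where c: "\<And>l. l \<in> L \<Longrightarrow> l \<le> c" "\<And>u. u \<in> U \<Longrightarrow> c \<le> u"
  proof (cases "L = {}")
    case True
    then show ?thesis using that[of 0] LU_empty by auto
  next
    case False
    then obtain u where "u \<in> U" using LU_empty by blast
    then have "bdd_above L" using LU by (meson bdd_aboveI)
    then show ?thesis
      using that[of "Sup L"] False LU by (auto intro: cSup_upper cSup_least)
  qed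
  \<comment> \<open>The coordinate of \<open>b\<close>; with it the value of \<open>\<phi>\<close> at \<open>b\<close> is changed to \<open>c\<close>.\<close>
  obtain \<pi> where \<pi>: "linear \<pi>" "\<And>v. v \<in> insert b A \<Longrightarrow> \<pi> v = (if v = b then 1 else (0::real))"
    using linear_independent_extend[OF ind, of "\<lambda>v. if v = b then 1 else (0::real)"] by blast
  have "b \<notin> A" using b span_base by blast
  then have \<pi>0: "\<pi> v = 0" if "v \<in> span A" for v
    using \<pi> linear_eq_0_on_span[of \<pi> A v] that by fastforce
  define \<psi> where "\<psi> = (\<lambda>v. \<phi> v + (c - \<phi> b) * \<pi> v)"
  have lin: "linear \<psi>"
    using \<phi>(1) \<pi>(1) unfolding \<psi>_def
    by (intro linearI) (auto simp: linear_add linear_scale algebra_simps)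
  have \<psi>A: "\<psi> v = \<phi> v" if "v \<in> span A" for v
    using \<pi>0[OF that] by (simp add: \<psi>_def)
  have \<psi>b: "\<psi> b = c" using \<pi>(2)[of b] by (simp add: \<psi>_def)
  have "\<psi> w \<le> h w" if wC: "w \<in> C" and wA: "w \<in> span (insert b A)" for w
  proof -
    obtain s where v: "w - s *\<^sub>R b \<in> span A"
      using wA unfolding span_breakdown_eq by blast
    have eq: "\<psi> w = \<phi> (w - s *\<^sub>R b) + s * c"
      using \<psi>A[OF v] \<psi>b lin by (simp add: linear_diff linear_scale)
    consider "s = 0" | "0 < s" | "s < 0" by linarith
    then show ?thesis
    proof cases
      case 1
      then show ?thesis using eq v \<phi>(2) wC by simp
    next
      case 2
      have "(h ((w - s *\<^sub>R b) + s *\<^sub>R b) - \<phi> (w - s *\<^sub>R b)) / s \<in> U"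
        unfolding U_def using 2 v wC by (intro CollectI exI conjI) auto
      from c(2)[OF this] show ?thesis using 2 eq by (simp add: field_simps)
    next
      case 3
      have "(\<phi> (w - s *\<^sub>R b) - h ((w - s *\<^sub>R b) - (- s) *\<^sub>R b)) / (- s) \<in> L"
        unfolding L_def using 3 v wC
        by (intro CollectI exI[of _ "w - s *\<^sub>R b"] exI[of _ "- s"] conjI) auto
      from c(1)[OF this] show ?thesis using 3 eq by (simp add: field_simps)
    qed
  qed
  with lin show ?case by blast
qed

lemma intrinsic_core_subset_subdiff_domain:
  fixes X :: "'a::real_normed_vector set"
  assumes fin: "finite (B::'a set)" "span B = UNIV" and d: "convex_on X d"
  shows "intrinsic_core X \<subseteq> subdiff_domain X d"
proof
  fix x assume x: "x \<in> intrinsic_core X"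
  then have xX: "x \<in> X" by (simp add: intrinsic_core_def)
  define C where "C = {v. x + v \<in> X}"
  define h where "h = (\<lambda>v. d (x + v) - d x)"
  have cX: "convex X" using d by (simp add: convex_on_def)
  have shift: "x + ((1 - t) *\<^sub>R v + t *\<^sub>R w) = (1 - t) *\<^sub>R (x + v) + t *\<^sub>R (x + w)" for t v w
    by (simp add: algebra_simps)
  have conv: "convex C"
    unfolding convex_alt C_def using convexD_alt[OF cX] by (auto simp: shift)
  have "convex_on C h"
  proof (rule convex_onI)
    fix t :: real and v w assume tv: "0 < t" "t < 1" "v \<in> C" "w \<in> C"
    have "d (x + ((1 - t) *\<^sub>R v + t *\<^sub>R w)) \<le> (1 - t) * d (x + v) + t * d (x + w)"
      unfolding shift using d tv by (intro convex_onD) (auto simp: C_def)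
    then show "h ((1 - t) *\<^sub>R v + t *\<^sub>R w) \<le> (1 - t) * h v + t * h w"
      by (simp add: h_def algebra_simps)
  qed (rule conv)
  moreover have "0 \<in> intrinsic_core C"
    unfolding intrinsic_core_def
  proof (intro CollectI conjI ballI)
    show "0 \<in> C" using xX by (simp add: C_def)
    fix v assume "v \<in> C"
    then have "x + v \<in> X" by (simp add: C_def)
    then obtain \<delta> where "0 < \<delta>" "x - \<delta> *\<^sub>R ((x + v) - x) \<in> X"
      using x unfolding intrinsic_core_def by blast
    then show "\<exists>\<delta>>0. 0 - \<delta> *\<^sub>R (v - 0) \<in> C"
      by (intro exI[of _ \<delta>]) (simp add: C_def)
  qed
  moreover obtain A where A: "A \<subseteq> B" "independent A" "B \<subseteq> span A"
    using maximal_independent_subset by blast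
  moreover have "finite A" using A fin finite_subset by blast
  ultimately obtain \<phi> where \<phi>: "linear \<phi>" "\<forall>v\<in>C \<inter> span A. \<phi> v \<le> h v"
    using convex_functional_minorant[of A C h] by (auto simp: h_def)
  have "span A = UNIV" using A(3) fin(2) by (metis span_minimal subspace_span top.extremum_uniqueI)
  then have bound: "\<phi> v \<le> h v" if "v \<in> C" for v using \<phi> that by auto
  have "bounded_linear \<phi>"
    using fin \<phi>(1) by (rule linear_functional_bounded_of_finite_span)
  then have app: "blinfun_apply (Blinfun \<phi>) = \<phi>" by (rule bounded_linear_Blinfun_apply)
  have "is_subgradient X d x (Blinfun \<phi>)"
    unfolding is_subgradient_def app using xX
  proof (intro conjI ballI)
    fix y assume "y \<in> X"
    then show "d x + \<phi> (y - x) \<le> d y"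
      using bound[of "y - x"] by (simp add: C_def h_def)
  qed auto
  then show "x \<in> subdiff_domain X d"
    using xX by (auto simp: subdiff_domain_def)
qed

section \<open>The mirror step\<close>

lemma minimizer_mem_subdiff_domain:
  assumes "is_arg_min (\<lambda>u. d u + blinfun_apply q u) (\<lambda>u. u \<in> X) y"
  shows "y \<in> subdiff_domain X d"
proof -
  have "y \<in> X" and "\<And>u. u \<in> X \<Longrightarrow> d y + blinfun_apply q y \<le> d u + blinfun_apply q u"
    using assms by (auto simp: is_arg_min_linorder)
  then have "is_subgradient X d y (- q)"
    unfolding is_subgradient_def
    by (force simp: blinfun.minus_left blinfun.diff_right)
  with \<open>y \<in> X\<close> show ?thesis by (auto simp: subdiff_domain_def)
qed

text \<open>
  On a segment from \<open>y\<close> to a core point \<open>w\<close> every point except possibly \<open>y\<close> is in the core. Add the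
  optimality of \<open>y\<close> and the subgradient inequality at such a point \<open>y + t (w - y)\<close>, divide by \<open>t\<close> and
  let \<open>t\<close> tend to \<open>0\<close>: by continuity of \<open>Dd\<close> this gives the claim for \<open>w\<close>. An arbitrary \<open>u \<in> X\<close> is
  the limit of the core points \<open>u + s (z - u)\<close>, and the claim is continuous in \<open>u\<close>.
\<close>

lemma prox_variational_inequality:
  fixes X :: "'a::real_normed_vector set"
  assumes fin: "finite (B::'a set)" "span B = UNIV"
    and z: "z \<in> rel_interior X"
    and prox: "prox_function X d Dd"
    and min: "is_arg_min (\<lambda>u. d u + blinfun_apply q u) (\<lambda>u. u \<in> X) y"
    and u: "u \<in> X"
  shows "0 \<le> blinfun_apply (q + Dd y) (u - y)"
proof -
  have d: "convex_on X d" and sub: "\<And>x. x \<in> subdiff_domain X d \<Longrightarrow> is_subgradient X d x (Dd x)"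
    and cont: "continuous_on (subdiff_domain X d) Dd"
    using prox by (auto simp: prox_function_def)
  have cX: "convex X" using d by (simp add: convex_on_def)
  have y0: "y \<in> subdiff_domain X d" using min by (rule minimizer_mem_subdiff_domain)
  have yX: "y \<in> X" and opt: "\<And>w. w \<in> X \<Longrightarrow> d y + blinfun_apply q y \<le> d w + blinfun_apply q w"
    using min by (auto simp: is_arg_min_linorder)
  have zc: "z \<in> intrinsic_core X" using z rel_interior_subset_intrinsic_core by blast
  have core: "0 \<le> blinfun_apply (q + Dd y) (w - y)" if w: "w \<in> intrinsic_core X" for w
  proof -
    let ?p = "\<lambda>t. y + t *\<^sub>R (w - y)"
    have pc: "?p t \<in> subdiff_domain X d" if "0 < t" "t \<le> 1" for t
      using intrinsic_core_segment[OF cX w yX that] intrinsic_core_subset_subdiff_domain[OF fin d]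
      by blast
    have pos: "0 \<le> blinfun_apply (q + Dd (?p t)) (w - y)" if t: "0 < t" "t \<le> 1" for t
    proof -
      have "is_subgradient X d (?p t) (Dd (?p t))" using sub pc t by blast
      then have "d (?p t) + blinfun_apply (Dd (?p t)) (y - ?p t) \<le> d y" and "?p t \<in> X"
        using yX unfolding is_subgradient_def by blast+
      moreover have "d y + blinfun_apply q y \<le> d (?p t) + blinfun_apply q (?p t)"
        using opt \<open>?p t \<in> X\<close> .
      ultimately have "0 \<le> t * blinfun_apply (q + Dd (?p t)) (w - y)"
        by (simp add: blinfun.add_left blinfun.add_right blinfun.scaleR_right
            blinfun.minus_right blinfun.diff_right algebra_simps)
      then show ?thesis using t by (simp add: zero_le_mult_iff)
    qed
    have "(?p \<longlongrightarrow> ?p 0) (at_right 0)" by (intro tendsto_intros)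
    moreover have ev: "\<forall>\<^sub>F t in at_right (0::real). 0 < t \<and> t < 1"
      by (auto simp: eventually_at_right_field intro: exI[of _ 1])
    moreover have "\<forall>\<^sub>F t in at_right 0. ?p t \<in> subdiff_domain X d"
      using ev by eventually_elim (use pc in auto)
    ultimately have "((\<lambda>t. Dd (?p t)) \<longlongrightarrow> Dd y) (at_right 0)"
      using y0 by (intro continuous_on_tendsto_compose[OF cont]) auto
    then have "((\<lambda>t. blinfun_apply (q + Dd (?p t)) (w - y)) \<longlongrightarrow> blinfun_apply (q + Dd y) (w - y))
        (at_right 0)"
      by (intro tendsto_intros)
    moreover have "\<forall>\<^sub>F t in at_right 0. 0 \<le> blinfun_apply (q + Dd (?p t)) (w - y)"
      using ev by eventually_elim (use pos in auto)
    ultimately show ?thesis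
      by (rule tendsto_lowerbound) (rule trivial_limit_at_right_real)
  qed
  have "((\<lambda>s. blinfun_apply (q + Dd y) (u + s *\<^sub>R (z - u) - y))
      \<longlongrightarrow> blinfun_apply (q + Dd y) (u + 0 *\<^sub>R (z - u) - y)) (at_right 0)"
    by (intro tendsto_intros)
  moreover have "\<forall>\<^sub>F s in at_right (0::real). 0 < s \<and> s < 1"
    by (auto simp: eventually_at_right_field intro: exI[of _ 1])
  then have "\<forall>\<^sub>F s in at_right 0. 0 \<le> blinfun_apply (q + Dd y) (u + s *\<^sub>R (z - u) - y)"
    by eventually_elim (use core intrinsic_core_segment[OF cX zc u] in auto)
  ultimately have "0 \<le> blinfun_apply (q + Dd y) (u + 0 *\<^sub>R (z - u) - y)"
    by (rule tendsto_lowerbound) (rule trivial_limit_at_right_real)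
  then show ?thesis by simp
qed

lemma is_mirr_iff_minimizer:
  "is_mirr X d Dd x p y \<longleftrightarrow>
    is_arg_min (\<lambda>u. d u + blinfun_apply (p - Dd x) u) (\<lambda>u. u \<in> X) y"
  by (simp add: is_mirr_def is_arg_min_linorder bregman_def blinfun.diff_left blinfun.diff_right
      algebra_simps)

text \<open>
  By the three-point identity, \<open>V[x](u) - V[y](u) - V[x](y) = \<langle>\<nabla>d(y) - \<nabla>d(x), u - y\<rangle>\<close>, which is at least
  \<open>\<langle>p, y - u\<rangle>\<close> by the variational inequality. The remaining term \<open>\<langle>p, x - y\<rangle>\<close> is absorbed by
  \<open>V[x](y)\<close>, through strong convexity and Young's inequality.
\<close>

lemma mirror_step_inequality:
  fixes X :: "'a::real_normed_vector set"
  assumes fin: "finite (B::'a set)" "span B = UNIV"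
    and z: "z \<in> rel_interior X"
    and prox: "prox_function X d Dd"
    and x: "x \<in> subdiff_domain X d"
    and mirr: "is_mirr X d Dd x p y"
    and u: "u \<in> X"
  shows "blinfun_apply p (x - u) \<le> bregman d Dd x u - bregman d Dd y u + (norm p)\<^sup>2 / 2"
proof -
  note min = mirr[unfolded is_mirr_iff_minimizer]
  have yX: "y \<in> X" using min by (simp add: is_arg_min_linorder)
  have "0 \<le> blinfun_apply (p - Dd x + Dd y) (u - y)"
    using fin z prox min u by (rule prox_variational_inequality)
  moreover have "(norm (y - x))\<^sup>2 / 2 \<le> bregman d Dd x y"
    using prox x yX by (simp add: prox_function_def bregman_def)
  moreover have "blinfun_apply p (x - y) \<le> (norm p)\<^sup>2 / 2 + (norm (y - x))\<^sup>2 / 2"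
  proof -
    have "blinfun_apply p (x - y) \<le> norm p * norm (y - x)"
      using norm_blinfun[of p "x - y"] by (simp add: norm_minus_commute)
    moreover have "0 \<le> (norm p - norm (y - x))\<^sup>2" by simp
    ultimately show ?thesis by (simp add: power2_diff)
  qed
  ultimately show ?thesis
    by (simp add: bregman_def blinfun.diff_left blinfun.add_left blinfun.diff_right)
qed

section \<open>Counting the iterations\<close>

text \<open>
  A small multiple of any direction stays in \<open>X\<close>, so that the growth of \<open>g\<close> along it bounds the
  functional. That \<open>M\<close> is nonnegative follows from \<open>p \<noteq> 0\<close>.
\<close>

lemma norm_subgradient_le_of_lipschitz:
  fixes X :: "'a::real_normed_vector set"
  assumes y: "y \<in> interior X" and sub: "is_subgradient UNIV g y p"
    and lip: "\<And>y z. y \<in> X \<Longrightarrow> z \<in> X \<Longrightarrow> \<bar>g y - g z\<bar> \<le> M * norm (y - z)"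
    and "p \<noteq> 0"
  shows "norm p \<le> M"
proof -
  obtain r where r: "0 < r" "cball y r \<subseteq> X"
    using y mem_interior_cball by blast
  have le: "blinfun_apply p h \<le> M * norm h" for h
  proof (cases "h = 0")
    case False
    define t where "t = r / norm h"
    have t: "0 < t" "t * norm h = r" using False r(1) by (auto simp: t_def)
    have "y \<in> X" "y + t *\<^sub>R h \<in> X"
      using r t by (auto simp: subset_iff dist_norm)
    then have "g (y + t *\<^sub>R h) - g y \<le> M * (t * norm h)"
      using lip[of "y + t *\<^sub>R h" y] t(1) by simp
    moreover have "g y + blinfun_apply p (t *\<^sub>R h) \<le> g (y + t *\<^sub>R h)"
      using sub unfolding is_subgradient_def
      by (metis UNIV_I add_diff_cancel_left')
    ultimately have "t * blinfun_apply p h \<le> t * (M * norm h)"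
      by (simp add: blinfun.scaleR_right algebra_simps)
    then show ?thesis using t(1) by simp
  qed (simp add: blinfun.zero_right)
  have abs: "norm (blinfun_apply p h) \<le> M * norm h" for h
    using le[of h] le[of "- h"] by (simp add: blinfun.minus_right)
  obtain h where "blinfun_apply p h \<noteq> 0"
    using \<open>p \<noteq> 0\<close> by (metis blinfun_eqI zero_blinfun.rep_eq)
  then have "0 < M * norm h" using abs[of h] by (metis less_le_trans zero_less_norm_iff)
  then have "0 \<le> M" by (metis less_eq_real_def norm_ge_zero not_le zero_less_mult_iff)
  then show ?thesis using abs by (rule norm_blinfun_bound)
qed

definition iteration_weight ::
  "('a::real_normed_vector \<Rightarrow> real) \<Rightarrow> ('a \<Rightarrow> 'a \<Rightarrow>\<^sub>L real) \<Rightarrow> real \<Rightarrow> 'a \<Rightarrow> real" where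
  "iteration_weight g Dg \<epsilon> y = (if g y \<le> \<epsilon> then 1 else 1 / (norm (Dg y))\<^sup>2)"

lemma amd_criterion_iff_sum_weights:
  "amd_criterion g Dg \<epsilon> \<Theta>\<^sub>0 x n \<longleftrightarrow>
    2 * \<Theta>\<^sub>0\<^sup>2 / \<epsilon>\<^sup>2 \<le> (\<Sum>j<n. iteration_weight g Dg \<epsilon> (x j))"
proof -
  have "(\<Sum>j<n. iteration_weight g Dg \<epsilon> (x j))
      = (\<Sum>j\<in>{..<n} \<inter> {j. g (x j) \<le> \<epsilon>}. 1) + (\<Sum>j\<in>{..<n} \<inter> - {j. g (x j) \<le> \<epsilon>}. 1 / (norm (Dg (x j)))\<^sup>2)"
    unfolding iteration_weight_def by (rule sum.If_cases) simp
  also have "{..<n} \<inter> {j. g (x j) \<le> \<epsilon>} = productive g \<epsilon> x n"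
    by (auto simp: productive_def)
  also have "{..<n} \<inter> - {j. g (x j) \<le> \<epsilon>} = nonproductive g \<epsilon> x n"
    by (auto simp: productive_def nonproductive_def)
  finally show ?thesis by (simp add: amd_criterion_def)
qed

text \<open>
  With \<open>p\<close> the functional of the mirror step, \<open>\<langle>p, x - u\<rangle>\<close> exceeds \<open>\<epsilon>\<^sup>2\<close> times the weight: at a
  productive point it is \<open>\<epsilon> v\<^sub>f[u](x)\<close>, and at a nonproductive one convexity bounds
  \<open>\<langle>\<nabla>g(x), x - u\<rangle>\<close> from below by \<open>g x - g u > \<epsilon>\<close>. In both cases \<open>\<parallel>p\<parallel>\<^sup>2\<close> is \<open>\<epsilon>\<^sup>2\<close> times the weight,
  so that half of the gain is left.
\<close>

lemma amd_step_decrease: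
  fixes X :: "'a::real_normed_vector set"
  assumes fin: "finite (B::'a set)" "span B = UNIV"
    and z: "z \<in> rel_interior X"
    and prox: "prox_function X d Dd"
    and x: "x \<in> subdiff_domain X d"
    and step: "amd_step X f Df g Dg d Dd \<epsilon> x x'"
    and eps: "0 < \<epsilon>"
    and u: "u \<in> X" "g u \<le> 0"
    and far: "g x \<le> \<epsilon> \<Longrightarrow> \<epsilon> < v_dist Df u x"
  shows "\<epsilon>\<^sup>2 / 2 * iteration_weight g Dg \<epsilon> x < bregman d Dd x u - bregman d Dd x' u"
proof (cases "g x \<le> \<epsilon>")
  case True
  let ?p = "(\<epsilon> / norm (Df x)) *\<^sub>R Df x"
  have nz: "Df x \<noteq> 0" using far[OF True] eps by (auto simp: v_dist_def)
  have "is_mirr X d Dd x ?p x'" using step True by (simp add: amd_step_def)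
  from mirror_step_inequality[OF fin z prox x this u(1)]
  have "blinfun_apply ?p (x - u) \<le> bregman d Dd x u - bregman d Dd x' u + \<epsilon>\<^sup>2 / 2"
    using nz eps by simp
  moreover have "blinfun_apply ?p (x - u) = \<epsilon> * v_dist Df u x"
    using nz by (simp add: v_dist_def blinfun.scaleR_left divide_inverse)
  moreover have "\<epsilon> * \<epsilon> < \<epsilon> * v_dist Df u x" using far[OF True] eps by simp
  ultimately show ?thesis
    using True by (simp add: iteration_weight_def power2_eq_square)
next
  case False
  let ?n = "norm (Dg x)" and ?p = "(\<epsilon> / (norm (Dg x))\<^sup>2) *\<^sub>R Dg x"
  have "is_subgradient UNIV g x (Dg x)" and mirr: "is_mirr X d Dd x ?p x'"
    using step False by (simp_all add: amd_step_def)
  then have "g x + blinfun_apply (Dg x) (u - x) \<le> g u" by (simp add: is_subgradient_def)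
  then have gap: "\<epsilon> < blinfun_apply (Dg x) (x - u)"
    using False u(2) by (simp add: blinfun.diff_right)
  then have "Dg x \<noteq> 0" using eps by auto
  then have n: "0 < ?n" by simp
  have "\<epsilon>\<^sup>2 / ?n\<^sup>2 < blinfun_apply ?p (x - u)"
    using gap n eps by (simp add: blinfun.scaleR_left power2_eq_square field_simps)
  also have "\<dots> \<le> bregman d Dd x u - bregman d Dd x' u + (norm ?p)\<^sup>2 / 2"
    by (rule mirror_step_inequality[OF fin z prox x mirr u(1)])
  also have "norm ?p = \<epsilon> / ?n"
    using n eps by (simp add: power2_eq_square)
  finally show ?thesis
    using False by (simp add: iteration_weight_def power_divide)
qed


theorem theorem5:
  fixes X :: "'a::real_normed_vector set"
    and f g d :: "'a \<Rightarrow> real"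
    and Df Dg Dd :: "'a \<Rightarrow> 'a \<Rightarrow>\<^sub>L real"
    and x :: "nat \<Rightarrow> 'a"
    and x_star :: 'a
    and M\<^sub>g \<Theta>\<^sub>0 \<epsilon> :: real
  assumes finite_dim: "\<exists>B::'a set. finite B \<and> span B = UNIV"
    and X: "closed X" "convex X"
    and f: "convex_on X f"
    and g: "convex_on UNIV g"
    and regular: "\<exists>z\<in>rel_interior X. g z < 0"
    and prox: "prox_function X d Dd"
    and lipschitz: "\<And>y z. y \<in> X \<Longrightarrow> z \<in> X \<Longrightarrow> \<bar>g y - g z\<bar> \<le> M\<^sub>g * norm (y - z)"
    (* At interior points of X this follows from lipschitz. At other points it says that the chosen
       subgradient respects the Lipschitz constant; without it the iteration bound fails. *)
    and subgradient_bound: "\<And>y. y \<in> frontier X \<Longrightarrow> \<epsilon> < g y \<Longrightarrow> norm (Dg y) \<le> M\<^sub>g"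
    and solution: "is_arg_min f (\<lambda>y. y \<in> X \<and> g y \<le> 0) x_star"
    and Theta: "0 < \<Theta>\<^sub>0" "d x_star \<le> \<Theta>\<^sub>0\<^sup>2"
    and eps: "0 < \<epsilon>"
    and run: "amd_run X f Df g Dg d Dd \<epsilon> \<Theta>\<^sub>0 x"
  shows "\<exists>N. amd_stops_after g Dg \<epsilon> \<Theta>\<^sub>0 x N \<and>
             int N \<le> \<lceil>2 * max 1 (M\<^sub>g\<^sup>2) * \<Theta>\<^sub>0\<^sup>2 / \<epsilon>\<^sup>2\<rceil> \<and>
             productive g \<epsilon> x N \<noteq> {} \<and>
             (MIN i\<in>productive g \<epsilon> x N. v_dist Df x_star (x i)) \<le> \<epsilon> \<and>
             (\<forall>u. amd_output f g \<epsilon> x N u \<longrightarrow> g u \<le> \<epsilon>)"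
proof -
  obtain B :: "'a set" where fin: "finite B" "span B = UNIV" using finite_dim by blast
  obtain z where z: "z \<in> rel_interior X" using regular by blast
  have star: "x_star \<in> X" "g x_star \<le> 0" using solution by (auto simp: is_arg_min_def)
  let ?w = "\<lambda>j. iteration_weight g Dg \<epsilon> (x j)"
  let ?crit = "amd_criterion g Dg \<epsilon> \<Theta>\<^sub>0 x"
  let ?step = "\<lambda>j. amd_step X f Df g Dg d Dd \<epsilon> (x j) (x (Suc j))"
  let ?V = "\<lambda>j. bregman d Dd (x j) x_star"
  have step: "?step k" if "\<forall>m\<in>{1..k}. \<not> ?crit m" for k
    using run that by (simp add: amd_run_def)
  \<comment> \<open>The starting point fits the results on mirror steps as the minimizer with zero functional.\<close>
  have min0: "is_arg_min (\<lambda>u. d u + blinfun_apply 0 u) (\<lambda>u. u \<in> X) (x 0)"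
    using run by (simp add: amd_run_def)
  have V0: "?V 0 \<le> \<Theta>\<^sub>0\<^sup>2"
  proof -
    have "0 \<le> blinfun_apply (Dd (x 0)) (x_star - x 0)"
      using prox_variational_inequality[OF fin z prox min0 star(1)] by simp
    moreover have "0 \<le> d (x 0)"
      using prox min0 by (auto simp: prox_function_def is_arg_min_linorder)
    ultimately show ?thesis using Theta(2) by (simp add: bregman_def)
  qed
  have dom: "x n \<in> subdiff_domain X d" if steps: "\<And>j. j < n \<Longrightarrow> ?step j" for n
  proof (cases n)
    case 0
    then show ?thesis using minimizer_mem_subdiff_domain[OF min0] by simp
  next
    case (Suc j)
    then obtain p where "is_mirr X d Dd (x j) p (x n)"
      using steps[of j] by (auto simp: amd_step_def split: if_splits)
    then show ?thesis
      unfolding is_mirr_iff_minimizer by (rule minimizer_mem_subdiff_domain)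
  qed
  have weight: "1 / max 1 (M\<^sub>g\<^sup>2) \<le> ?w j" if steps: "\<And>i. i \<le> j \<Longrightarrow> ?step i" for j
  proof (cases "g (x j) \<le> \<epsilon>")
    case True
    then show ?thesis by (simp add: iteration_weight_def)
  next
    case False
    have xX: "x j \<in> X" using dom[of j] steps by (auto simp: subdiff_domain_def)
    have sub: "is_subgradient UNIV g (x j) (Dg (x j))"
      using steps[of j] False by (simp add: amd_step_def)
    have nz: "Dg (x j) \<noteq> 0"
    proof
      assume "Dg (x j) = 0"
      then have "g (x j) \<le> g x_star" using sub by (simp add: is_subgradient_def)
      then show False using star(2) eps False by simp
    qed
    have "norm (Dg (x j)) \<le> M\<^sub>g"
    proof (cases "x j \<in> interior X")
      case True
      then show ?thesis using sub lipschitz nz by (rule norm_subgradient_le_of_lipschitz)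
    next
      case outer: False
      then have "x j \<in> frontier X" using xX closure_subset by (auto simp: frontier_def)
      then show ?thesis using subgradient_bound False by simp
    qed
    then have "(norm (Dg (x j)))\<^sup>2 \<le> max 1 (M\<^sub>g\<^sup>2)"
      by (meson max.coboundedI2 norm_ge_zero power_mono)
    then show ?thesis using False nz by (simp add: iteration_weight_def frac_le)
  qed
  define K where "K = nat \<lceil>2 * max 1 (M\<^sub>g\<^sup>2) * \<Theta>\<^sub>0\<^sup>2 / \<epsilon>\<^sup>2\<rceil>"
  have ratio_pos: "0 < 2 * max 1 (M\<^sub>g\<^sup>2) * \<Theta>\<^sub>0\<^sup>2 / \<epsilon>\<^sup>2"
    using Theta(1) eps by (intro divide_pos_pos mult_pos_pos) (auto simp: less_max_iff_disj)
  then have K: "1 \<le> K" "int K = \<lceil>2 * max 1 (M\<^sub>g\<^sup>2) * \<Theta>\<^sub>0\<^sup>2 / \<epsilon>\<^sup>2\<rceil>"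
    unfolding K_def by linarith+
  have "\<exists>m. m \<in> {1..K} \<and> ?crit m"
  proof (rule ccontr)
    assume none: "\<not> ?thesis"
    then have steps: "?step j" if "j < K" for j using that by (intro step) auto
    have "2 * max 1 (M\<^sub>g\<^sup>2) * \<Theta>\<^sub>0\<^sup>2 / \<epsilon>\<^sup>2 \<le> real K"
      unfolding K_def by (rule real_nat_ceiling_ge)
    then have "2 * \<Theta>\<^sub>0\<^sup>2 / \<epsilon>\<^sup>2 \<le> real K * (1 / max 1 (M\<^sub>g\<^sup>2))"
      by (simp add: pos_le_divide_eq less_max_iff_disj mult_ac)
    also have "\<dots> \<le> (\<Sum>j<K. ?w j)"
      using sum_mono[of "{..<K}" "\<lambda>_. 1 / max 1 (M\<^sub>g\<^sup>2)" ?w] weight steps by simp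
    finally have "?crit K" by (simp add: amd_criterion_iff_sum_weights)
    then show False using none K(1) by auto
  qed
  then obtain m where m: "m \<in> {1..K} \<and> ?crit m" by blast
  define N where "N = (LEAST m. m \<in> {1..K} \<and> ?crit m)"
  have N: "N \<in> {1..K}" "?crit N"
    using LeastI[of "\<lambda>m. m \<in> {1..K} \<and> ?crit m", OF m] by (auto simp: N_def)
  have before: "\<not> ?crit n" if "n \<in> {1..<N}" for n
    using not_less_Least[of n "\<lambda>m. m \<in> {1..K} \<and> ?crit m"] that N(1) by (auto simp: N_def)
  have steps: "?step j" if "j < N" for j
    using that before by (intro step) auto
  have "\<exists>i\<in>productive g \<epsilon> x N. v_dist Df x_star (x i) \<le> \<epsilon>"
  proof (rule ccontr)
    assume far: "\<not> ?thesis"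
    have "\<epsilon>\<^sup>2 / 2 * ?w j < ?V j - ?V (Suc j)" if j: "j < N" for j
    proof (rule amd_step_decrease[OF fin z prox _ steps[OF j] eps star])
      show "x j \<in> subdiff_domain X d" using dom steps j by simp
      show "\<epsilon> < v_dist Df x_star (x j)" if "g (x j) \<le> \<epsilon>"
        using far that j by (auto simp: productive_def)
    qed
    then have "(\<Sum>j<N. \<epsilon>\<^sup>2 / 2 * ?w j) < (\<Sum>j<N. ?V j - ?V (Suc j))"
      using N(1) by (intro sum_strict_mono) (auto simp: lessThan_empty_iff)
    also have "\<dots> = ?V 0 - ?V N" by (rule sum_lessThan_telescope')
    also have "\<dots> \<le> \<Theta>\<^sub>0\<^sup>2"
    proof -
      have "(norm (x_star - x N))\<^sup>2 / 2 \<le> ?V N"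
        using prox dom[of N] steps star(1) by (simp add: prox_function_def bregman_def)
      then have "0 \<le> ?V N" by (rule order_trans[rotated]) simp
      then show ?thesis using V0 by simp
    qed
    \<comment> \<open>The telescoped bound and the stopping criterion are incompatible because the former is
      strict: the sum is over a nonempty range, and every iteration decreases the divergence by
      strictly more than its share.\<close>
    finally have "\<epsilon>\<^sup>2 / 2 * (\<Sum>j<N. ?w j) < \<Theta>\<^sub>0\<^sup>2" by (simp add: sum_distrib_left)
    moreover have "2 * \<Theta>\<^sub>0\<^sup>2 / \<epsilon>\<^sup>2 \<le> (\<Sum>j<N. ?w j)"
      using N(2) by (simp add: amd_criterion_iff_sum_weights)
    ultimately show False using eps by (simp add: field_simps)
  qed
  then obtain i where i: "i \<in> productive g \<epsilon> x N" "v_dist Df x_star (x i) \<le> \<epsilon>" by blast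
  have "finite (productive g \<epsilon> x N)" by (simp add: productive_def)
  then have "(MIN i\<in>productive g \<epsilon> x N. v_dist Df x_star (x i)) \<le> v_dist Df x_star (x i)"
    using i(1) by (intro Min_le) auto
  moreover have "amd_stops_after g Dg \<epsilon> \<Theta>\<^sub>0 x N"
    using N before by (simp add: amd_stops_after_def)
  moreover have "int N \<le> \<lceil>2 * max 1 (M\<^sub>g\<^sup>2) * \<Theta>\<^sub>0\<^sup>2 / \<epsilon>\<^sup>2\<rceil>"
    using N(1) by (simp flip: K(2))
  moreover have "g u \<le> \<epsilon>" if "amd_output f g \<epsilon> x N u" for u
    using that by (auto simp: amd_output_def is_arg_min_def productive_def)
  ultimately show ?thesis using i by (intro exI[of _ N]) auto
qed

end
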